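(* Let $N_A$ be a seminorm on $\mathbb{B}_A(\mathcal{H})$ and let $T\in\mathbb{B}_A(\mathcal{H})$. Then $$\frac12 N_A(T)\le\omega_{N_A}(T).$$ In particular, if $N_A$ is $A$-selfadjoint invariant, then $$\frac12 N_A(T)\le\omega_{N_A}(T)\le N_A(T).$$
   Context: $\mathcal{H}$ is a complex Hilbert space with inner product $\langle\cdot,\cdot\rangle$, $\mathbb{B}(\mathcal{H})$ is the algebra of bounded linear operators on $\mathcal{H}$, and $A\in\mathbb{B}(\mathcal{H})$ is a non-zero positive operator ($\langle Ax,x\rangle\ge 0$ for all $x$). $\mathbb{B}_A(\mathcal{H})$ is the set of $T\in\mathbb{B}(\mathcal{H})$ with $\mathcal{R}(T^*A)\subseteq\mathcal{R}(A)$ ($\mathcal{R}$ denotes range); it is a subalgebra of $\mathbb{B}(\mathcal{H})$. For $T\in\mathbb{B}_A(\mathcal{H})$, $T^{\sharp_A}$ is the unique $X\in\mathbb{B}(\mathcal{H})$ with $AX=T^*A$ and $\mathcal{R}(X)\subseteq\overline{\mathcal{R}(A)}$; one has $T^{\sharp_A}\in\mathbb{B}_A(\mathcal{H})$. Put $\Re_A(T)=\frac{T+T^{\sharp_A}}{2}$. For a seminorm $N_A$ on $\mathbb{B}_A(\mathcal{H})$, the generalized $A$-numerical radius is $\omega_{N_A}(T)=\sup_{\theta\in\mathbb{R}}N_A\big(\Re_A(e^{i\theta}T)\big)$ for $T\in\mathbb{B}_A(\mathcal{H})$. $N_A$ is $A$-selfadjoint invariant if $N_A(T)=N_A(T^{\sharp_A})$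 for all $T\in\mathbb{B}_A(\mathcal{H})$. *)

theory Defs
  imports "HOL-Analysis.Analysis"
begin

text \<open>
  Complex inner product spaces, on top of the real inner product space obtained by
  restricting scalars: the real inner product is the real part of the complex one, so the
  inherited norm is \<open>sqrt \<langle>x, x\<rangle>\<close>. The complex inner product is linear in its first argument.
  The laws \<open>1 x = x\<close> and \<open>\<langle>x, x\<rangle> \<ge> 0\<close> (with equality only for \<open>x = 0\<close>) follow from the
  corresponding laws of \<^class>\<open>real_inner\<close>.
\<close>

class complex_inner = real_inner +
  fixes scaleC :: "complex \<Rightarrow> 'a \<Rightarrow> 'a" (infixr "*\<^sub>C" 75)
    and cinner :: "'a \<Rightarrow> 'a \<Rightarrow> complex"
  assumes scaleC_add_right: "c *\<^sub>C (x + y) = c *\<^sub>C x + c *\<^sub>C y"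
    and scaleC_add_left: "(c + d) *\<^sub>C x = c *\<^sub>C x + d *\<^sub>C x"
    and scaleC_scaleC: "c *\<^sub>C (d *\<^sub>C x) = (c * d) *\<^sub>C x"
    and scaleR_scaleC: "r *\<^sub>R x = complex_of_real r *\<^sub>C x"
    and cinner_commute: "cinner x y = cnj (cinner y x)"
    and cinner_add_left: "cinner (x + y) z = cinner x z + cinner y z"
    and cinner_scaleC_left: "cinner (c *\<^sub>C x) y = c * cinner x y"
    and inner_eq_Re_cinner: "inner x y = Re (cinner x y)"

class chilbert_space = complex_inner + complete_space

instantiation complex :: chilbert_space
begin

definition scaleC_complex :: "complex \<Rightarrow> complex \<Rightarrow> complex"
  where "scaleC_complex c x = c * x"

definition cinner_complex :: "complex \<Rightarrow> complex \<Rightarrow> complex"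
  where "cinner_complex x y = x * cnj y"

instance
  by standard
    (simp_all add: scaleC_complex_def cinner_complex_def inner_complex_def scaleR_conv_of_real
      algebra_simps)

end

definition bounded_clinear :: "('a::complex_inner \<Rightarrow> 'a) \<Rightarrow> bool"
  where "bounded_clinear T \<longleftrightarrow> bounded_linear T \<and> (\<forall>c x. T (c *\<^sub>C x) = c *\<^sub>C T x)"

definition positive_op :: "('a::complex_inner \<Rightarrow> 'a) \<Rightarrow> bool"
  where "positive_op A \<longleftrightarrow> bounded_clinear A \<and> (\<forall>x. cinner (A x) x \<in> \<real>\<^sub>\<ge>\<^sub>0)"

definition cadjoint :: "('a::chilbert_space \<Rightarrow> 'a) \<Rightarrow> 'a \<Rightarrow> 'a"
  where "cadjoint T =
    (THE S. bounded_clinear S \<and> (\<forall>x y. cinner (T x) y = cinner x (S y)))"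

definition BA :: "('a::chilbert_space \<Rightarrow> 'a) \<Rightarrow> ('a \<Rightarrow> 'a) set"
  where "BA A = {T. bounded_clinear T \<and> range (cadjoint T \<circ> A) \<subseteq> range A}"

definition A_sharp :: "('a::chilbert_space \<Rightarrow> 'a) \<Rightarrow> ('a \<Rightarrow> 'a) \<Rightarrow> 'a \<Rightarrow> 'a"
  where "A_sharp A T =
    (THE X. bounded_clinear X \<and> A \<circ> X = cadjoint T \<circ> A \<and> range X \<subseteq> closure (range A))"

definition Re_A :: "('a::chilbert_space \<Rightarrow> 'a) \<Rightarrow> ('a \<Rightarrow> 'a) \<Rightarrow> 'a \<Rightarrow> 'a"
  where "Re_A A T = (\<lambda>x. (T x + A_sharp A T x) /\<^sub>R 2)"

text \<open>
  Functionals on \<open>BA A\<close> are functions on the whole type \<open>'a \<Rightarrow> 'a\<close> of which only the values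
  on \<open>BA A\<close> matter.
\<close>

definition seminorm_on_BA :: "('a::chilbert_space \<Rightarrow> 'a) \<Rightarrow> (('a \<Rightarrow> 'a) \<Rightarrow> real) \<Rightarrow> bool"
  where "seminorm_on_BA A N \<longleftrightarrow>
    (\<forall>T\<in>BA A. 0 \<le> N T) \<and>
    (\<forall>T\<in>BA A. \<forall>c. N (\<lambda>x. c *\<^sub>C T x) = cmod c * N T) \<and>
    (\<forall>S\<in>BA A. \<forall>T\<in>BA A. N (\<lambda>x. S x + T x) \<le> N S + N T)"

definition A_selfadjoint_invariant ::
    "('a::chilbert_space \<Rightarrow> 'a) \<Rightarrow> (('a \<Rightarrow> 'a) \<Rightarrow> real) \<Rightarrow> bool"
  where "A_selfadjoint_invariant A N \<longleftrightarrow> (\<forall>T\<in>BA A. N T = N (A_sharp A T))"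

text \<open>
  For a seminorm \<open>N\<close> and \<open>T\<close> in \<open>BA A\<close> the supremum is over a set bounded above by
  \<open>(N T + N (A_sharp A T)) / 2\<close>, so taking it in the reals is harmless.
\<close>

definition gen_A_numerical_radius ::
    "('a::chilbert_space \<Rightarrow> 'a) \<Rightarrow> (('a \<Rightarrow> 'a) \<Rightarrow> real) \<Rightarrow> ('a \<Rightarrow> 'a) \<Rightarrow> real"
  where "gen_A_numerical_radius A N T =
    (SUP \<theta>::real. N (Re_A A (\<lambda>x. exp (\<i> * complex_of_real \<theta>) *\<^sub>C T x)))"

end

theory Submission
  imports Defs
begin

text \<open>
  Write \<open>T\<^sup>\<sharp>\<close> for the \<open>A\<close>-adjoint \<open>A_sharp A T\<close>. As \<open>T \<mapsto> T\<^sup>\<sharp>\<close> is conjugate-homogeneous,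
  the \<open>A\<close>-real part of \<open>c T\<close> is \<open>(c T + cnj c T\<^sup>\<sharp>) / 2\<close>. For \<open>c = 1\<close> and \<open>c = - \<i>\<close> these are
  the \<open>A\<close>-real and \<open>A\<close>-imaginary parts of \<open>T\<close>, and
  \<open>T = Re_A T + \<i> Re_A (- \<i> T)\<close>.
  Both parts occur in the supremum that defines the numerical radius, so the triangle
  inequality bounds \<open>N T\<close> by twice the radius. The triangle inequality also gives
  \<open>N (Re_A (c T)) \<le> (N T + N T\<^sup>\<sharp>) / 2\<close> for \<open>\<bar>c\<bar> = 1\<close>: the supremum is over a bounded set, and it
  is at most \<open>N T\<close> when \<open>N T\<^sup>\<sharp> = N T\<close>.

  Both arguments need that \<open>T\<^sup>\<sharp>\<close> really has its defining properties, since the adjoint and the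
  \<open>A\<close>-adjoint are introduced by definite description. The adjoint comes from the Riesz
  representation theorem. The \<open>A\<close>-adjoint is an instance of Douglas factorization: the closure of
  the range of \<open>A\<close> is the orthogonal complement of its kernel, and \<open>A\<close> is injective there, so
  \<open>A v = T\<^sup>* A x\<close> has exactly one solution \<open>v\<close> in it, linear in \<open>x\<close>. That the solution is bounded
  in \<open>x\<close> is the substantial point (\<open>is_A_sharp_exists\<close>). It follows from the uniform boundedness
  principle applied to the vectors \<open>A T u\<close> with \<open>\<parallel>A u\<parallel> \<le> 1\<close>, whose inner products with \<open>x\<close> equal
  \<open>\<langle>v, A u\<rangle>\<close> and so are at most \<open>\<parallel>v\<parallel>\<close>.

  All operators are complex-linear, which makes the real and the complex inner product
  interchangeable in these identities; the proofs use the real one.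
\<close>

section \<open>Projection, representation and uniform boundedness in Hilbert space\<close>

text \<open>
  Points of \<open>S\<close> whose distances to \<open>x\<close> tend to the infimum form a Cauchy sequence by the
  parallelogram law, because the midpoint of two of them is again in \<open>S\<close>. Their limit is a
  nearest point \<open>p\<close>, and \<open>x - p\<close> is orthogonal to \<open>S\<close> because moving \<open>p\<close> within \<open>S\<close> cannot
  decrease the distance.
\<close>

lemma closed_subspace_projection:
  fixes S :: "'a::{real_inner,complete_space} set"
  assumes "closed S" and "subspace S"
  shows "\<exists>p\<in>S. \<forall>s\<in>S. inner (x - p) s = 0"
proof -
  define d where "d = infdist x S"
  have ne: "S \<noteq> {}" using assms(2) subspace_0 by blast
  have "\<exists>a\<in>S. dist x a < d + 1 / real (Suc n)" for n
    using cInf_lessD[of "dist x ` S" "d + 1 / real (Suc n)"] ne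
    by (auto simp: d_def infdist_def)
  then obtain a where aS: "\<And>n. a n \<in> S" and an: "\<And>n. dist x (a n) < d + 1 / real (Suc n)"
    by metis
  have d0: "d \<ge> 0" unfolding d_def by (rule infdist_nonneg)
  have dle: "d \<le> norm (x - s)" if "s \<in> S" for s
    using infdist_le[OF that, of x] by (simp add: d_def dist_norm)
  define \<epsilon> where "\<epsilon> n = (d + 1 / real (Suc n))\<^sup>2 - d\<^sup>2" for n
  have lim: "\<epsilon> \<longlonglongrightarrow> 0"
  proof -
    have "\<epsilon> \<longlonglongrightarrow> (d + 0)\<^sup>2 - d\<^sup>2"
      unfolding \<epsilon>_def by (intro tendsto_intros LIMSEQ_Suc[OF lim_1_over_n])
    then show ?thesis by simp
  qed
  have par: "(dist (a m) (a n))\<^sup>2 \<le> 2 * \<epsilon> m + 2 * \<epsilon> n" for m n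
  proof -
    define u v where "u = x - a m" and "v = x - a n"
    have "(1/2) *\<^sub>R (a m + a n) \<in> S"
      using aS assms(2) by (intro subspace_scale subspace_add)
    from dle[OF this] have "d \<le> norm ((1/2) *\<^sub>R (u + v))"
      by (simp add: u_def v_def algebra_simps flip: scaleR_add_left)
    then have 1: "(2 * d)\<^sup>2 \<le> (norm (u + v))\<^sup>2" using d0 by (intro power_mono) auto
    have 2: "(norm u)\<^sup>2 \<le> (d + 1 / real (Suc m))\<^sup>2" "(norm v)\<^sup>2 \<le> (d + 1 / real (Suc n))\<^sup>2"
      using an[of m] an[of n] by (auto simp: u_def v_def dist_norm intro!: power_mono)
    have 3: "(norm (v - u))\<^sup>2 = 2 * (norm u)\<^sup>2 + 2 * (norm v)\<^sup>2 - (norm (u + v))\<^sup>2"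
      by (simp add: power2_norm_eq_inner inner_commute algebra_simps)
    have "dist (a m) (a n) = norm (v - u)" by (simp add: u_def v_def dist_norm)
    with 1 2 3 show ?thesis by (simp add: \<epsilon>_def power_mult_distrib)
  qed
  have "Cauchy a"
  proof (rule metric_CauchyI)
    fix e :: real assume "e > 0"
    then obtain M where M: "\<And>n. n \<ge> M \<Longrightarrow> \<bar>\<epsilon> n\<bar> < e\<^sup>2 / 4"
      using LIMSEQ_D[OF lim, of "e\<^sup>2 / 4"] by auto
    show "\<exists>M. \<forall>m\<ge>M. \<forall>n\<ge>M. dist (a m) (a n) < e"
    proof (intro exI allI impI)
      fix m n assume "M \<le> m" "M \<le> n"
      then have "(dist (a m) (a n))\<^sup>2 < e\<^sup>2" using par[of m n] M[of m] M[of n] by linarith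
      then show "dist (a m) (a n) < e" using \<open>e > 0\<close> by (simp add: power_less_imp_less_base)
    qed
  qed
  then obtain p where p: "a \<longlonglongrightarrow> p" using Cauchy_convergent convergent_def by blast
  have pS: "p \<in> S" using closed_sequentially[OF assms(1)] aS p by blast
  have pd: "norm (x - p) \<le> d"
  proof (rule LIMSEQ_le)
    show "(\<lambda>n. dist x (a n)) \<longlonglongrightarrow> norm (x - p)"
      unfolding dist_norm by (intro tendsto_intros p)
    have "(\<lambda>n. d + 1 / real (Suc n)) \<longlonglongrightarrow> d + 0"
      by (intro tendsto_intros LIMSEQ_Suc[OF lim_1_over_n])
    then show "(\<lambda>n. d + 1 / real (Suc n)) \<longlonglongrightarrow> d" by simp
    show "\<exists>N. \<forall>n\<ge>N. dist x (a n) \<le> d + 1 / real (Suc n)" using an less_imp_le by blast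
  qed
  have "inner (x - p) s = 0" if s: "s \<in> S" for s
  proof (cases "s = 0")
    case False
    \<comment> \<open>the multiple of \<open>s\<close> that minimizes the distance from \<open>x - p\<close>\<close>
    define t where "t = inner (x - p) s / inner s s"
    have ss: "inner s s > 0" using False by simp
    have "p + t *\<^sub>R s \<in> S" using pS s assms(2) by (intro subspace_scale subspace_add)
    from dle[OF this] pd have "norm (x - p) \<le> norm ((x - p) - t *\<^sub>R s)" by (simp add: algebra_simps)
    then have "(norm (x - p))\<^sup>2 \<le> (norm ((x - p) - t *\<^sub>R s))\<^sup>2" by (intro power_mono) auto
    also have "\<dots> = (norm (x - p))\<^sup>2 - 2 * t * inner (x - p) s + t\<^sup>2 * inner s s"
      unfolding power2_norm_eq_inner
      by (simp add: inner_diff_left inner_diff_right inner_commute power2_eq_square)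
    also have "\<dots> = (norm (x - p))\<^sup>2 - (inner (x - p) s)\<^sup>2 / inner s s"
      using ss unfolding t_def by (simp add: field_simps power2_eq_square)
    finally have "(inner (x - p) s)\<^sup>2 / inner s s \<le> 0" by simp
    then show ?thesis using ss by (simp add: divide_le_0_iff)
  qed simp
  with pS show ?thesis by blast
qed

text \<open>
  For \<open>f \<noteq> 0\<close> the kernel has codimension one, so the representing vector is a multiple of any
  non-zero vector \<open>q\<close> orthogonal to it.
\<close>

lemma riesz_representation:
  fixes f :: "'a::{real_inner,complete_space} \<Rightarrow> real"
  assumes "bounded_linear f"
  shows "\<exists>z. \<forall>x. f x = inner x z"
proof (cases "\<forall>x. f x = 0")
  case True
  then show ?thesis by (intro exI[of _ 0]) simp
next
  case False
  interpret f: bounded_linear f by fact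
  define K where "K = {x. f x = 0}"
  have "closed K"
    unfolding K_def by (intro closed_Collect_eq continuous_intros f.continuous_on)
  moreover have "subspace K"
    by (auto simp: K_def subspace_def f.add f.scaleR f.zero)
  moreover obtain x0 where "f x0 \<noteq> 0" using False by blast
  ultimately obtain p where p: "p \<in> K" "\<And>s. s \<in> K \<Longrightarrow> inner (x0 - p) s = 0"
    using closed_subspace_projection[of K x0] by blast
  define q where "q = x0 - p"
  have fq: "f q \<noteq> 0" using p(1) \<open>f x0 \<noteq> 0\<close> by (simp add: q_def K_def f.diff)
  then have q0: "inner q q \<noteq> 0" using f.zero by auto
  have "f x = inner x ((f q / inner q q) *\<^sub>R q)" for x
  proof -
    have "x - (f x / f q) *\<^sub>R q \<in> K" using fq by (simp add: K_def f.diff f.scaleR)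
    from p(2)[OF this] have "inner q x = f x / f q * inner q q"
      by (simp add: q_def[symmetric] inner_diff_right)
    then show ?thesis using fq q0 by (simp add: inner_commute)
  qed
  then show ?thesis by blast
qed

text \<open>
  The vector \<open>S y\<close> represents the functional \<open>x \<mapsto> \<langle>T x, y\<rangle>\<close>, and taking \<open>x = S y\<close> bounds its
  norm.
\<close>

lemma adjoint_exists:
  fixes T :: "'a::{real_inner,complete_space} \<Rightarrow> 'a"
  assumes "bounded_linear T"
  shows "\<exists>S. bounded_linear S \<and> (\<forall>x y. inner (T x) y = inner x (S y))"
proof -
  interpret T: bounded_linear T by fact
  have "\<exists>z. \<forall>x. inner (T x) y = inner x z" for y
    by (rule riesz_representation)
      (rule bounded_linear_compose[OF bounded_linear_inner_left assms])
  then obtain S where S: "\<And>x y. inner (T x) y = inner x (S y)" by metis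
  obtain K where K: "K \<ge> 0" "\<And>x. norm (T x) \<le> norm x * K" using T.nonneg_bounded by blast
  have "bounded_linear S"
  proof (rule bounded_linear_intro)
    show "S (y + z) = S y + S z" for y z
      unfolding vector_eq_ldot[symmetric, of "S (y + z)"]
      by (simp add: S[symmetric] inner_add_right)
    show "S (r *\<^sub>R y) = r *\<^sub>R S y" for r y
      unfolding vector_eq_ldot[symmetric, of "S (r *\<^sub>R y)"]
      by (simp add: S[symmetric])
    show "norm (S y) \<le> norm y * K" for y
    proof (cases "S y = 0")
      case False
      have "norm (S y) * norm (S y) = inner (T (S y)) y"
        by (simp add: S norm_eq_sqrt_inner)
      also have "\<dots> \<le> norm (T (S y)) * norm y" by (rule norm_cauchy_schwarz)
      also have "\<dots> \<le> norm (S y) * K * norm y" by (intro mult_right_mono K norm_ge_zero)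
      finally have "norm (S y) * norm (S y) \<le> norm (S y) * (norm y * K)" by (simp add: mult_ac)
      then show ?thesis using False by simp
    qed (use K in simp)
  qed
  with S show ?thesis by blast
qed

text \<open>
  The uniform boundedness principle for functionals, with functionals represented by vectors. By
  Baire's theorem, the functionals from \<open>B\<close> are uniformly bounded on some ball, and hence on
  the ball of the same radius around the origin.
\<close>

lemma weakly_bounded_imp_bounded:
  fixes B :: "'a::{real_inner,complete_space} set"
  assumes "\<And>x. \<exists>M. \<forall>b\<in>B. \<bar>inner x b\<bar> \<le> M"
  shows "bounded B"
proof -
  define E where "E n = {x. \<forall>b\<in>B. \<bar>inner x b\<bar> \<le> real n}" for n
  have clE: "closed (E n)" for n
  proof -
    have "E n = (\<Inter>b\<in>B. {x. \<bar>inner x b\<bar> \<le> real n})" by (auto simp: E_def)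
    then show ?thesis by (auto intro!: closed_INT closed_Collect_le continuous_intros)
  qed
  have "(\<Union>n. E n) = UNIV"
  proof -
    have "\<exists>n. x \<in> E n" for x
    proof -
      obtain M where M: "\<forall>b\<in>B. \<bar>inner x b\<bar> \<le> M" using assms by blast
      obtain n where "M \<le> real n" using real_arch_simple by blast
      with M have "x \<in> E n" unfolding E_def by force
      then show ?thesis ..
    qed
    then show ?thesis by blast
  qed
  then have "interior (\<Union>(range E)) \<noteq> {}" by simp
  then obtain n where "interior (E n) \<noteq> {}"
    using Baire_category_alt[of "euclidean :: 'a topology" "range E"] clE
      completely_metrizable_space_euclidean
    by auto
  then obtain a r where r: "r > 0" and ball: "cball a r \<subseteq> E n"
    by (metis all_not_in_conv mem_interior_cball)
  have "norm b \<le> 2 * real n / r" if b: "b \<in> B" for b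
  proof (cases "b = 0")
    case False
    \<comment> \<open>the point of the ball of radius \<open>r\<close> around the origin whose inner product with \<open>b\<close> is largest\<close>
    define u where "u = (r / norm b) *\<^sub>R b"
    have "a + u \<in> E n" "a \<in> E n" using r False by (auto intro!: subsetD[OF ball] simp: u_def dist_norm)
    with b have "\<bar>inner (a + u) b\<bar> \<le> real n" "\<bar>inner a b\<bar> \<le> real n" by (auto simp: E_def)
    then have "inner u b \<le> 2 * real n" by (simp add: inner_add_left)
    moreover have "inner u b = r * norm b" using False
      by (simp add: u_def power2_norm_eq_inner[symmetric] power2_eq_square)
    ultimately show ?thesis using r by (simp add: field_simps)
  qed (use r in simp)
  then show ?thesis unfolding bounded_iff by blast
qed

section \<open>Reduction to the real inner product\<close>

lemma scaleC_zero_right [simp]: "c *\<^sub>C (0::'a::complex_inner) = 0"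
  using scaleC_add_right[of c "0::'a" 0] by simp

lemma inner_scaleC_left: "inner (c *\<^sub>C x) y = inner x (cnj c *\<^sub>C y)"
  for x y :: "'a::complex_inner"
  by (metis cinner_commute cinner_scaleC_left complex_cnj_cnj complex_cnj_mult inner_eq_Re_cinner)

text \<open>
  The real inner product determines the complex one. An identity between real inner products that
  holds for all arguments therefore gives the complex identity as soon as both sides are compatible
  with multiplication by \<open>\<i>\<close>.
\<close>

lemma cinner_eq_inner: "cinner x y = Complex (inner x y) (inner x (\<i> *\<^sub>C y))"
  for x y :: "'a::complex_inner"
proof -
  have "inner x (\<i> *\<^sub>C y) = inner ((-\<i>) *\<^sub>C x) y" by (simp add: inner_scaleC_left)
  then show ?thesis
    by (simp add: complex_eq_iff inner_eq_Re_cinner cinner_scaleC_left)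
qed

lemma norm_scaleC: "norm (c *\<^sub>C x) = cmod c * norm x"
  for x :: "'a::complex_inner"
proof -
  have "(norm (c *\<^sub>C x))\<^sup>2 = inner x ((cnj c * c) *\<^sub>C x)"
    by (simp add: power2_norm_eq_inner inner_scaleC_left scaleC_scaleC)
  also have "cnj c * c = complex_of_real ((cmod c)\<^sup>2)"
    by (metis complex_norm_square mult.commute)
  finally have "(norm (c *\<^sub>C x))\<^sup>2 = (cmod c * norm x)\<^sup>2"
    by (simp add: scaleR_scaleC[symmetric] power_mult_distrib power2_norm_eq_inner
        del: of_real_power)
  then show ?thesis by (simp add: power2_eq_iff_nonneg)
qed

lemma bounded_clinear_scaleC: "bounded_clinear ((*\<^sub>C) c)"
  unfolding bounded_clinear_def
  by (auto intro!: bounded_linear_intro[where K = "cmod c"]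
      simp: scaleC_add_right norm_scaleC scaleC_scaleC scaleR_scaleC mult.commute)

lemma bounded_clinear_add:
  "bounded_clinear S \<Longrightarrow> bounded_clinear T \<Longrightarrow> bounded_clinear (\<lambda>x. S x + T x)"
  by (simp add: bounded_clinear_def bounded_linear_add scaleC_add_right)

lemma bounded_clinear_compose:
  "bounded_clinear S \<Longrightarrow> bounded_clinear T \<Longrightarrow> bounded_clinear (\<lambda>x. S (T x))"
  by (simp add: bounded_clinear_def bounded_linear_compose)

lemma bounded_clinear_scale:
  fixes T :: "'a::complex_inner \<Rightarrow> 'a"
  assumes "bounded_clinear T"
  shows "bounded_clinear (\<lambda>x. c *\<^sub>C T x)"
  using bounded_clinear_scaleC assms by (rule bounded_clinear_compose)

text \<open>
  A real adjoint of a complex-linear operator is automatically complex-linear, so the real theory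
  also yields the complex adjoint.
\<close>

lemma cinner_adjoint_iff_inner:
  fixes T S :: "'a::complex_inner \<Rightarrow> 'a"
  assumes "bounded_clinear T"
  shows "bounded_clinear S \<and> (\<forall>x y. cinner (T x) y = cinner x (S y)) \<longleftrightarrow>
    bounded_linear S \<and> (\<forall>x y. inner (T x) y = inner x (S y))" (is "?L \<longleftrightarrow> ?R")
proof
  assume ?L
  then show ?R by (simp add: bounded_clinear_def inner_eq_Re_cinner)
next
  assume R: ?R
  have "S (c *\<^sub>C y) = c *\<^sub>C S y" for c y
  proof -
    have "inner x (S (c *\<^sub>C y)) = inner x (c *\<^sub>C S y)" for x
    proof -
      have "inner x (S (c *\<^sub>C y)) = inner (cnj c *\<^sub>C T x) y"
        using R by (metis complex_cnj_cnj inner_scaleC_left)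
      also have "cnj c *\<^sub>C T x = T (cnj c *\<^sub>C x)"
        using assms by (simp add: bounded_clinear_def)
      also have "inner (T (cnj c *\<^sub>C x)) y = inner x (c *\<^sub>C S y)"
        using R by (simp add: inner_scaleC_left)
      finally show ?thesis .
    qed
    then show ?thesis using vector_eq_ldot by blast
  qed
  then show ?L using R by (simp add: bounded_clinear_def cinner_eq_inner)
qed

lemma inner_cadjoint:
  fixes T :: "'a::chilbert_space \<Rightarrow> 'a"
  assumes "bounded_clinear T"
  shows "inner (T x) y = inner x (cadjoint T y)"
proof -
  have "\<exists>!S. bounded_clinear S \<and> (\<forall>x y. cinner (T x) y = cinner x (S y))"
    unfolding cinner_adjoint_iff_inner[OF assms]
  proof (rule ex_ex1I)
    show "\<exists>S. bounded_linear S \<and> (\<forall>x y. inner (T x) y = inner x (S y))"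
      using assms by (intro adjoint_exists) (simp add: bounded_clinear_def)
    show "S = S'" if "bounded_linear S \<and> (\<forall>x y. inner (T x) y = inner x (S y))"
      "bounded_linear S' \<and> (\<forall>x y. inner (T x) y = inner x (S' y))" for S S'
      using that by (metis ext vector_eq_ldot)
  qed
  from theI'[OF this] show ?thesis
    unfolding cadjoint_def[symmetric] by (simp add: inner_eq_Re_cinner)
qed

text \<open>
  This turns equations that involve the adjoint into identities of inner products, in which
  only \<open>T\<close> occurs.
\<close>

lemma cadjoint_eq_iff:
  fixes T :: "'a::chilbert_space \<Rightarrow> 'a"
  assumes "bounded_clinear T"
  shows "z = cadjoint T u \<longleftrightarrow> (\<forall>y. inner z y = inner u (T y))"
  using inner_cadjoint[OF assms] by (metis inner_commute vector_eq_ldot)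

text \<open>
  Polarization: the quadratic form of \<open>A\<close> has no imaginary part, that is,
  \<open>\<langle>A x, \<i> x\<rangle> = 0\<close> in the real inner product. Hence the bilinear form \<open>\<langle>A x, \<i> y\<rangle>\<close> is
  antisymmetric, and replacing \<open>y\<close> by \<open>\<i> y\<close> gives symmetry of \<open>\<langle>A x, y\<rangle>\<close>.
\<close>

lemma positive_op_selfadjoint:
  fixes A :: "'a::complex_inner \<Rightarrow> 'a"
  assumes "positive_op A"
  shows "inner (A x) y = inner x (A y)"
proof -
  have lin: "bounded_linear A" and cl: "A (c *\<^sub>C x) = c *\<^sub>C A x" for c x
    using assms by (auto simp: positive_op_def bounded_clinear_def)
  interpret A: bounded_linear A by (rule lin)
  have z: "inner (A x) (\<i> *\<^sub>C x) = 0" for x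
    using assms by (auto simp: positive_op_def cinner_eq_inner complex_nonneg_Reals_iff)
  have pol: "inner (A x) (\<i> *\<^sub>C y) = - inner (A y) (\<i> *\<^sub>C x)" for x y
    using z[of "x + y"] z[of x] z[of y]
    by (simp add: A.add scaleC_add_right inner_add_left inner_add_right)
  have i2: "\<i> *\<^sub>C \<i> *\<^sub>C y = - y" for y :: 'a
    using scaleR_scaleC[of "-1" y] by (simp add: scaleC_scaleC)
  have "inner (A x) y = - inner (A x) (\<i> *\<^sub>C \<i> *\<^sub>C y)" by (simp add: i2)
  also have "\<dots> = inner (\<i> *\<^sub>C A y) (\<i> *\<^sub>C x)" by (simp add: pol cl)
  also have "\<dots> = inner (A y) x"
    by (simp add: inner_scaleC_left scaleC_scaleC scaleR_scaleC[of 1, simplified, symmetric])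
  finally show ?thesis by (simp add: inner_commute)
qed

section \<open>The \<open>A\<close>-adjoint\<close>

lemma subspace_closure:
  fixes S :: "'a::real_normed_vector set"
  assumes "subspace S"
  shows "subspace (closure S)"
  unfolding subspace_def
proof (intro conjI ballI allI)
  show "0 \<in> closure S" using subspace_0[OF assms] closure_subset by blast
next
  fix x y assume "x \<in> closure S" "y \<in> closure S"
  then obtain f g where "\<forall>n. f n \<in> S" "f \<longlonglongrightarrow> x" "\<forall>n. g n \<in> S" "g \<longlonglongrightarrow> y"
    by (auto simp: closure_sequential)
  then show "x + y \<in> closure S"
    unfolding closure_sequential
    by (intro exI[of _ "\<lambda>n. f n + g n"]) (auto intro: tendsto_add subspace_add[OF assms])
next
  fix c x assume "x \<in> closure S"
  then obtain f where "\<forall>n. f n \<in> S" "f \<longlonglongrightarrow> x"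
    by (auto simp: closure_sequential)
  then show "c *\<^sub>R x \<in> closure S"
    unfolding closure_sequential
    by (intro exI[of _ "\<lambda>n. c *\<^sub>R f n"]) (auto intro: tendsto_scaleR subspace_scale[OF assms])
qed

text \<open>
  Since \<open>A\<close> is self-adjoint, its range is orthogonal to its kernel. Conversely, for \<open>v\<close>
  orthogonal to the kernel, the component \<open>w\<close> of \<open>v\<close> orthogonal to the closure of the range
  satisfies \<open>\<parallel>A w\<parallel>\<^sup>2 = \<langle>w, A (A w)\<rangle> = 0\<close>. So \<open>w\<close> lies in the kernel, is orthogonal to \<open>v\<close>,
  and vanishes.
\<close>

lemma closure_range_eq_kernel_orthogonal:
  fixes A :: "'a::{real_inner,complete_space} \<Rightarrow> 'a"
  assumes "bounded_linear A" and sa: "\<And>x y. inner (A x) y = inner x (A y)"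
  shows "v \<in> closure (range A) \<longleftrightarrow> (\<forall>k. A k = 0 \<longrightarrow> inner v k = 0)"
proof
  assume v: "v \<in> closure (range A)"
  show "\<forall>k. A k = 0 \<longrightarrow> inner v k = 0"
  proof (intro allI impI)
    fix k assume k: "A k = 0"
    have "closed {v. inner v k = 0}" by (intro closed_Collect_eq continuous_intros)
    moreover have "range A \<subseteq> {v. inner v k = 0}" using k by (auto simp: sa)
    ultimately show "inner v k = 0" using v closure_minimal by blast
  qed
next
  assume v: "\<forall>k. A k = 0 \<longrightarrow> inner v k = 0"
  interpret A: bounded_linear A by fact
  have "subspace (closure (range A))"
    by (intro subspace_closure linear_subspace_image A.linear_axioms subspace_UNIV)
  then obtain p where p: "p \<in> closure (range A)"
    "\<And>s. s \<in> closure (range A) \<Longrightarrow> inner (v - p) s = 0"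
    using closed_subspace_projection[of "closure (range A)" v] by auto
  have "inner (v - p) (A (A (v - p))) = 0" using p(2) closure_subset by blast
  then have "inner (A (v - p)) (A (v - p)) = 0" by (simp only: sa[of "v - p" "A (v - p)"])
  then have "A (v - p) = 0" by simp
  with v have "inner v (v - p) = 0" by blast
  moreover have "inner (v - p) p = 0" using p by blast
  ultimately have "inner (v - p) (v - p) = 0" by (simp add: inner_diff_left inner_diff_right inner_commute)
  with p(1) show "v \<in> closure (range A)" by simp
qed

lemma preimage_orthogonal_to_kernel_exists:
  fixes A :: "'a::{real_inner,complete_space} \<Rightarrow> 'a"
  assumes "bounded_linear A"
  shows "\<exists>v. A v = A w \<and> (\<forall>k. A k = 0 \<longrightarrow> inner v k = 0)"
proof -
  interpret A: bounded_linear A by fact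
  have "closed {k. A k = 0}" by (intro closed_Collect_eq continuous_intros A.continuous_on)
  moreover have "subspace {k. A k = 0}" by (auto simp: subspace_def A.add A.scaleR A.zero)
  ultimately obtain p where "A p = 0" "\<And>k. A k = 0 \<Longrightarrow> inner (w - p) k = 0"
    using closed_subspace_projection[of "{k. A k = 0}" w] by auto
  then show ?thesis by (intro exI[of _ "w - p"]) (simp add: A.diff)
qed

text \<open>
  The vector \<open>A w\<close> is \<open>T\<^sup>* A x\<close>. In this form membership is stable under algebraic operations
  by direct choice of \<open>w\<close>, without computing adjoints of sums or multiples.
\<close>

lemma mem_BA_iff:
  fixes A T :: "'a::chilbert_space \<Rightarrow> 'a"
  shows "T \<in> BA A \<longleftrightarrow>
    bounded_clinear T \<and> (\<forall>x. \<exists>w. \<forall>y. inner (A w) y = inner (A x) (T y))"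
proof (cases "bounded_clinear T")
  case True
  have "T \<in> BA A \<longleftrightarrow> (\<forall>x. \<exists>w. A w = cadjoint T (A x))"
    using True by (auto simp: BA_def image_subset_iff) (metis rangeE rangeI)+
  then show ?thesis using True by (simp add: cadjoint_eq_iff)
qed (simp add: BA_def)

text \<open>
  The defining properties of the \<open>A\<close>-adjoint, restated without the adjoint \<open>T\<^sup>*\<close> and without the
  closure: the equation \<open>A X = T\<^sup>* A\<close> is tested against all vectors, and the closure of the range
  of \<open>A\<close> is replaced by the orthogonal complement of its kernel.
\<close>

definition is_A_sharp :: "('a::chilbert_space \<Rightarrow> 'a) \<Rightarrow> ('a \<Rightarrow> 'a) \<Rightarrow> ('a \<Rightarrow> 'a) \<Rightarrow> bool"
  where "is_A_sharp A T X \<longleftrightarrow> bounded_clinear X \<and>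
    (\<forall>x y. inner (A (X x)) y = inner (A x) (T y)) \<and> (\<forall>x k. A k = 0 \<longrightarrow> inner (X x) k = 0)"

lemma preimage_orthogonal_to_kernel_unique:
  fixes A :: "'a::real_inner \<Rightarrow> 'a"
  assumes "bounded_linear A" and "A v = A w"
    and "\<And>k. A k = 0 \<Longrightarrow> inner v k = 0" and "\<And>k. A k = 0 \<Longrightarrow> inner w k = 0"
  shows "v = w"
proof -
  interpret A: bounded_linear A by fact
  have "A (v - w) = 0" using assms(2) by (simp add: A.diff)
  with assms(3,4) have "inner (v - w) (v - w) = 0" by (simp add: inner_diff_left)
  then show ?thesis by simp
qed

text \<open>
  Solving \<open>A v = T\<^sup>* A x\<close> for \<open>v\<close> orthogonal to the kernel of \<open>A\<close> defines \<open>X x\<close> pointwise, and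
  linearity follows from uniqueness. Boundedness rests on \<open>\<langle>x, A (T v)\<rangle> = \<langle>X x, A v\<rangle>\<close>. Bounding the right-hand
  side by \<open>\<parallel>X x\<parallel> \<parallel>A v\<parallel>\<close> shows that the vectors \<open>A (T v)\<close> with \<open>\<parallel>A v\<parallel> \<le> 1\<close> are weakly bounded, hence
  bounded by some \<open>C\<close>. Bounding the left-hand side by \<open>\<parallel>x\<parallel> \<parallel>A (T v)\<parallel>\<close> then gives
  \<open>\<langle>X x, u\<rangle> \<le> C \<parallel>x\<parallel> \<parallel>u\<parallel>\<close> for \<open>u\<close> in the range of \<open>A\<close>. This persists on the closure of the range,
  where \<open>u = X x\<close> is allowed.
\<close>

lemma is_A_sharp_exists:
  fixes A T :: "'a::chilbert_space \<Rightarrow> 'a"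
  assumes pos: "positive_op A" and T: "T \<in> BA A"
  shows "\<exists>X. is_A_sharp A T X"
proof -
  have Acl: "bounded_clinear A" using pos by (simp add: positive_op_def)
  then have Abl: "bounded_linear A" and AC: "\<And>c x. A (c *\<^sub>C x) = c *\<^sub>C A x"
    by (auto simp: bounded_clinear_def)
  note sa = positive_op_selfadjoint[OF pos]
  interpret A: bounded_linear A by fact
  have Tcl: "bounded_clinear T" using T by (simp add: mem_BA_iff)
  then have TC: "\<And>c x. T (c *\<^sub>C x) = c *\<^sub>C T x" and "bounded_linear T"
    by (auto simp: bounded_clinear_def)
  interpret T: bounded_linear T by fact
  have "\<exists>v. (\<forall>y. inner (A v) y = inner (A x) (T y)) \<and> (\<forall>k. A k = 0 \<longrightarrow> inner v k = 0)" for x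
    using T preimage_orthogonal_to_kernel_exists[OF Abl] unfolding mem_BA_iff by metis
  then obtain X where X: "\<And>x y. inner (A (X x)) y = inner (A x) (T y)"
    and Xk: "\<And>x k. A k = 0 \<Longrightarrow> inner (X x) k = 0" by metis
  have eqX: "X x = v" if "\<And>y. inner (A v) y = inner (A x) (T y)"
    and "\<And>k. A k = 0 \<Longrightarrow> inner v k = 0" for x v
  proof (rule preimage_orthogonal_to_kernel_unique[OF Abl])
    show "A (X x) = A v" using that(1) X vector_eq_rdot by metis
  qed (use Xk that(2) in auto)
  have add: "X (x + y) = X x + X y" for x y
    by (rule eqX) (simp_all add: A.add inner_add_left X Xk)
  have kC: "A (c *\<^sub>C k) = 0" if "A k = 0" for c k using that by (simp add: AC)
  have scC: "X (c *\<^sub>C x) = c *\<^sub>C X x" for c x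
    by (rule eqX) (simp_all add: AC inner_scaleC_left X TC Xk kC)
  have weak: "inner x (A (T v)) = inner (X x) (A v)" for x v
    by (metis X sa)
  define B where "B = {A (T v) |v. norm (A v) \<le> 1}"
  have "bounded B"
  proof (rule weakly_bounded_imp_bounded)
    fix x
    have "\<bar>inner x b\<bar> \<le> norm (X x)" if "b \<in> B" for b
    proof -
      obtain v where v: "b = A (T v)" "norm (A v) \<le> 1" using \<open>b \<in> B\<close> by (auto simp: B_def)
      have "\<bar>inner (X x) (A v)\<bar> \<le> norm (X x) * norm (A v)" by (rule Cauchy_Schwarz_ineq2)
      also have "\<dots> \<le> norm (X x)" using v(2) by (simp add: mult_left_le)
      finally show ?thesis by (simp add: v(1) weak)
    qed
    then show "\<exists>M. \<forall>b\<in>B. \<bar>inner x b\<bar> \<le> M" by blast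
  qed
  then obtain C where C: "C > 0" "\<And>b. b \<in> B \<Longrightarrow> norm b \<le> C" by (auto simp: bounded_pos)
  have le: "inner (X x) (A v) \<le> norm x * C * norm (A v)" for x v
  proof (cases "A v = 0")
    case False
    define t where "t = inverse (norm (A v))"
    have "norm (A (t *\<^sub>R v)) \<le> 1" using False by (simp add: A.scaleR t_def)
    then have "A (T (t *\<^sub>R v)) \<in> B" unfolding B_def by blast
    from C(2)[OF this] have "norm (A (T v)) \<le> C * norm (A v)"
      using False by (simp add: A.scaleR T.scaleR t_def field_simps)
    then have "norm x * norm (A (T v)) \<le> norm x * (C * norm (A v))"
      by (intro mult_left_mono) auto
    moreover have "inner (X x) (A v) \<le> norm x * norm (A (T v))"
      unfolding weak[symmetric] by (rule norm_cauchy_schwarz)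
    ultimately show ?thesis by simp
  qed simp
  have bd: "norm (X x) \<le> norm x * C" for x
  proof -
    have "closed {u. inner (X x) u \<le> norm x * C * norm u}"
      by (intro closed_Collect_le continuous_intros)
    moreover have "range A \<subseteq> {u. inner (X x) u \<le> norm x * C * norm u}" using le by auto
    moreover have "X x \<in> closure (range A)"
      using Xk closure_range_eq_kernel_orthogonal[OF Abl sa] by blast
    ultimately have "inner (X x) (X x) \<le> norm x * C * norm (X x)"
      using closure_minimal by blast
    then have "norm (X x) * norm (X x) \<le> norm x * C * norm (X x)"
      by (simp add: power2_norm_eq_inner flip: power2_eq_square)
    then show ?thesis using C(1) by (cases "X x = 0") auto
  qed
  have "bounded_clinear X"
    unfolding bounded_clinear_def
    by (auto intro!: bounded_linear_intro[where K = C] simp: add scC bd scaleR_scaleC)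
  with X Xk show ?thesis unfolding is_A_sharp_def by blast
qed

lemma A_sharp_eq:
  fixes A T :: "'a::chilbert_space \<Rightarrow> 'a"
  assumes pos: "positive_op A" and T: "bounded_clinear T" and X: "is_A_sharp A T X"
  shows "A_sharp A T = X"
proof -
  have Abl: "bounded_linear A" using pos by (simp add: positive_op_def bounded_clinear_def)
  have iff: "bounded_clinear Y \<and> A \<circ> Y = cadjoint T \<circ> A \<and> range Y \<subseteq> closure (range A) \<longleftrightarrow>
      is_A_sharp A T Y" for Y
    by (auto simp: is_A_sharp_def fun_eq_iff cadjoint_eq_iff[OF T] image_subset_iff
        closure_range_eq_kernel_orthogonal[OF Abl positive_op_selfadjoint[OF pos]])
  show ?thesis
    unfolding A_sharp_def iff
  proof (rule the_equality)
    show "is_A_sharp A T X" by (rule X)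
  next
    fix Y assume Y: "is_A_sharp A T Y"
    show "Y = X"
    proof
      fix x
      have "A (Y x) = A (X x)"
        using X Y unfolding is_A_sharp_def by (metis vector_eq_rdot)
      then show "Y x = X x"
        using X Y preimage_orthogonal_to_kernel_unique[OF Abl] unfolding is_A_sharp_def by blast
    qed
  qed
qed

lemma is_A_sharp_A_sharp:
  assumes "positive_op A" and "T \<in> BA A"
  shows "is_A_sharp A T (A_sharp A T)"
  using is_A_sharp_exists[OF assms] A_sharp_eq[OF assms(1)] assms(2) mem_BA_iff by metis

text \<open>
  Because \<open>A\<close> is self-adjoint, \<open>A X = T\<^sup>* A\<close> implies \<open>X\<^sup>* A = A T\<close>, whose range is contained in
  that of \<open>A\<close>.
\<close>

lemma A_sharp_in_BA:
  fixes A T :: "'a::chilbert_space \<Rightarrow> 'a"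
  assumes pos: "positive_op A" and "T \<in> BA A"
  shows "A_sharp A T \<in> BA A"
proof -
  note sa = positive_op_selfadjoint[OF pos]
  have X: "is_A_sharp A T (A_sharp A T)" using assms by (rule is_A_sharp_A_sharp)
  have "inner (A (T x)) y = inner (A x) (A_sharp A T y)" for x y
    using X unfolding is_A_sharp_def by (metis inner_commute sa)
  then show ?thesis using X unfolding mem_BA_iff is_A_sharp_def by blast
qed

lemma BA_scaleC:
  fixes A T :: "'a::chilbert_space \<Rightarrow> 'a"
  assumes "bounded_clinear A" and "T \<in> BA A"
  shows "(\<lambda>x. c *\<^sub>C T x) \<in> BA A"
  unfolding mem_BA_iff
proof (intro conjI allI)
  show "bounded_clinear (\<lambda>x. c *\<^sub>C T x)"
    using assms(2) by (simp add: mem_BA_iff bounded_clinear_scale)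
  fix x
  obtain w where "\<forall>y. inner (A w) y = inner (A (cnj c *\<^sub>C x)) (T y)"
    using assms(2) unfolding mem_BA_iff by blast
  then show "\<exists>w. \<forall>y. inner (A w) y = inner (A x) (c *\<^sub>C T y)"
    using assms(1) by (auto simp: bounded_clinear_def inner_scaleC_left)
qed

lemma BA_add:
  fixes A S T :: "'a::chilbert_space \<Rightarrow> 'a"
  assumes "bounded_clinear A" and "S \<in> BA A" and "T \<in> BA A"
  shows "(\<lambda>x. S x + T x) \<in> BA A"
  unfolding mem_BA_iff
proof (intro conjI allI)
  show "bounded_clinear (\<lambda>x. S x + T x)"
    using assms by (intro bounded_clinear_add) (auto simp: mem_BA_iff)
  fix x
  obtain v w where "\<forall>y. inner (A v) y = inner (A x) (S y)" "\<forall>y. inner (A w) y = inner (A x) (T y)"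
    using assms(2,3) unfolding mem_BA_iff by blast
  moreover have "A (v + w) = A v + A w"
    using assms(1) by (simp add: bounded_clinear_def linear_simps)
  ultimately show "\<exists>w. \<forall>y. inner (A w) y = inner (A x) (S y + T y)"
    by (intro exI[of _ "v + w"]) (simp add: inner_add_left inner_add_right)
qed

lemma A_sharp_scaleC:
  fixes A T :: "'a::chilbert_space \<Rightarrow> 'a"
  assumes pos: "positive_op A" and T: "T \<in> BA A"
  shows "A_sharp A (\<lambda>x. c *\<^sub>C T x) = (\<lambda>x. cnj c *\<^sub>C A_sharp A T x)"
proof (rule A_sharp_eq[OF pos])
  show "bounded_clinear (\<lambda>x. c *\<^sub>C T x)"
    using T by (simp add: bounded_clinear_scale mem_BA_iff)
  have AC: "A (c *\<^sub>C x) = c *\<^sub>C A x" for c x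
    using pos by (simp add: positive_op_def bounded_clinear_def)
  have TC: "T (c *\<^sub>C x) = c *\<^sub>C T x" for c x
    using T by (simp add: mem_BA_iff bounded_clinear_def)
  have X: "is_A_sharp A T (A_sharp A T)" using assms by (rule is_A_sharp_A_sharp)
  then show "is_A_sharp A (\<lambda>x. c *\<^sub>C T x) (\<lambda>x. cnj c *\<^sub>C A_sharp A T x)"
    by (simp add: bounded_clinear_scale is_A_sharp_def AC TC inner_scaleC_left)
qed

section \<open>The generalized numerical radius\<close>

lemma Re_A_scaleC:
  fixes A T :: "'a::chilbert_space \<Rightarrow> 'a"
  assumes "positive_op A" and "T \<in> BA A"
  shows "Re_A A (\<lambda>x. c *\<^sub>C T x) = (\<lambda>x. (c / 2) *\<^sub>C T x + (cnj c / 2) *\<^sub>C A_sharp A T x)"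
  by (simp add: Re_A_def A_sharp_scaleC[OF assms] scaleR_scaleC scaleC_add_right scaleC_scaleC)

theorem theorem2p7:
  fixes A T :: "'a::chilbert_space \<Rightarrow> 'a" and N :: "('a \<Rightarrow> 'a) \<Rightarrow> real"
  assumes "positive_op A" and "A \<noteq> (\<lambda>x. 0)"
    and "seminorm_on_BA A N"
    and "T \<in> BA A"
  shows "1 / 2 * N T \<le> gen_A_numerical_radius A N T \<and>
    (A_selfadjoint_invariant A N \<longrightarrow>
      1 / 2 * N T \<le> gen_A_numerical_radius A N T \<and> gen_A_numerical_radius A N T \<le> N T)"
proof -
  let ?X = "A_sharp A T"
  define R where "R \<theta> = Re_A A (\<lambda>x. exp (\<i> * complex_of_real \<theta>) *\<^sub>C T x)" for \<theta> :: real
  have scale: "\<And>S c. S \<in> BA A \<Longrightarrow> N (\<lambda>x. c *\<^sub>C S x) = cmod c * N S"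
    and tri: "\<And>S S'. S \<in> BA A \<Longrightarrow> S' \<in> BA A \<Longrightarrow> N (\<lambda>x. S x + S' x) \<le> N S + N S'"
    using assms(3) by (auto simp: seminorm_on_BA_def)
  have Acl: "bounded_clinear A" using assms(1) by (simp add: positive_op_def)
  note sc = BA_scaleC[OF Acl] and ad = BA_add[OF Acl]
  have X: "?X \<in> BA A" using assms(1,4) by (rule A_sharp_in_BA)
  have R: "R \<theta> = (\<lambda>x. (exp (\<i> * \<theta>) / 2) *\<^sub>C T x + (cnj (exp (\<i> * \<theta>)) / 2) *\<^sub>C ?X x)" for \<theta>
    unfolding R_def by (rule Re_A_scaleC[OF assms(1,4)])
  have RBA: "R \<theta> \<in> BA A" for \<theta>
    unfolding R by (intro ad sc assms(4) X)
  have upper: "N (R \<theta>) \<le> (N T + N ?X) / 2" for \<theta>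
    unfolding R using tri[OF sc sc, OF assms(4) X, of "exp (\<i> * \<theta>) / 2" "cnj (exp (\<i> * \<theta>)) / 2"]
    by (simp add: scale[OF assms(4)] scale[OF X] norm_divide)
  have radius: "gen_A_numerical_radius A N T = (SUP \<theta>. N (R \<theta>))"
    by (simp add: gen_A_numerical_radius_def R_def)
  have R_le: "N (R \<theta>) \<le> gen_A_numerical_radius A N T" for \<theta>
    unfolding radius by (rule cSUP_upper[OF UNIV_I bdd_aboveI2[OF upper]])
  \<comment> \<open>the Cartesian decomposition; the angle \<open>- pi / 2\<close> gives the factor \<open>- \<i>\<close>\<close>
  have "T = (\<lambda>x. R 0 x + \<i> *\<^sub>C R (- (pi / 2)) x)"
  proof
    fix x
    have e: "exp (\<i> * complex_of_real (- (pi / 2))) = - \<i>"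
      unfolding cis_conv_exp[symmetric] by (simp add: complex_eq_iff)
    have "R 0 x + \<i> *\<^sub>C R (- (pi / 2)) x
        = ((1/2) *\<^sub>C T x + (1/2) *\<^sub>C T x) + ((1/2) *\<^sub>C ?X x + (-1/2) *\<^sub>C ?X x)"
      unfolding R e by (simp add: scaleC_add_right scaleC_scaleC)
    also have "\<dots> = 1 *\<^sub>C T x + 0 *\<^sub>C ?X x" by (simp flip: scaleC_add_left)
    also have "\<dots> = T x"
      using scaleR_scaleC[of 1 "T x"] scaleR_scaleC[of 0 "?X x"] by simp
    finally show "T x = R 0 x + \<i> *\<^sub>C R (- (pi / 2)) x" by simp
  qed
  then have "N T \<le> N (R 0) + N (\<lambda>x. \<i> *\<^sub>C R (- (pi / 2)) x)"
    using tri[OF RBA sc[OF RBA]] by metis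
  also have "\<dots> = N (R 0) + N (R (- (pi / 2)))" by (simp add: scale[OF RBA])
  also have "\<dots> \<le> 2 * gen_A_numerical_radius A N T"
    using R_le[of 0] R_le[of "- (pi / 2)"] by simp
  finally have lower: "1 / 2 * N T \<le> gen_A_numerical_radius A N T" by simp
  have "gen_A_numerical_radius A N T \<le> N T" if "A_selfadjoint_invariant A N"
  proof -
    have "N ?X = N T" using that assms(4) by (simp add: A_selfadjoint_invariant_def)
    with upper show ?thesis unfolding radius by (intro cSUP_least) auto
  qed
  with lower show ?thesis by blast
qed

end
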